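(* Let $p_1,\dots,p_m$ be p-values with hypothesis indicators $H_1,\dots,H_m\in\{0,1\}$ ($H_i=0$ means the $i$th null hypothesis is true). Assume the p-values are mutually independent, and that for every $i$ with $H_i=0$, $p_i$ has density $f_0$ on $[0,1]$ satisfying $$\int_0^a f_0(u)\,du\le \int_{1-a}^1 f_0(u)\,du\quad\text{for all }a\in[0,1].$$ For each $i$ let $h_i:[0,1]\to[0,\infty)$ be strictly decreasing and $\pi_i\in(0,1)$. Suppose the $h_i$ and $\pi_i$ are deterministic, i.e. chosen independently of the p-values. For $t\in(0,1)$ set $w_i(t)=\frac{(1-t)\pi_i}{t(1-\pi_i)}$. Fix $t_{\mathrm{up}}\in(0,1)$ with $w_i(t_{\mathrm{up}})\ge h_i(0.5)$ for all $i$. Fix $\alpha\in(0,1)$ and define $$t^*=\max\Big\{t\in(0,t_{\mathrm{up}}]:\ \frac{1+\sum_{i=1}^m\mathbf 1\{h_i(1-p_i)\ge w_i(t)\}}{1\vee\sum_{i=1}^m\mathbf 1\{h_i(p_i)\ge w_i(t)\}}\le\alpha\Big\}.$$ Reject the $i$th hypothesis iff $h_i(p_i)\ge w_i(t^* )$; if the set defining $t^*$ is empty, reject nothing. Then this procedure controls the false discovery rate at level $\alpha$ in finite samples: $$E\Big[\frac{\sum_{i=1}^m(1-H_i)\mathbf 1\{h_i(p_i)\ge w_i(t^* )\}}{1\vee\sum_{i=1}^m\mathbf 1\{h_i(p_i)\ge w_i(t^* )\}}\Big]\le\alpha.$$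
   Context: Here $a\vee b=\max\{a,b\}$. The expectation is over the random p-values; the indicators $H_i$ are fixed.
   Formalization: The set defining t* need not have a maximum (the estimated ratio can jump above α just at a point where a mirrored p-value enters), so t* is taken to be the supremum of the set, which equals the maximum whenever the maximum exists. *)

theory Defs
  imports "HOL-Probability.Probability"
begin

definition wgt :: "real \<Rightarrow> real \<Rightarrow> real" where
  "wgt pi_i t = ((1 - t) * pi_i) / (t * (1 - pi_i))"

definition fdp_hat ::
  "nat \<Rightarrow> (nat \<Rightarrow> real \<Rightarrow> real) \<Rightarrow> (nat \<Rightarrow> real) \<Rightarrow> (nat \<Rightarrow> real) \<Rightarrow> real \<Rightarrow> real" where
  "fdp_hat m h \<pi> q t =
     (1 + real (card {i\<in>{..<m}. h i (1 - q i) \<ge> wgt (\<pi> i) t}))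
     / max 1 (real (card {i\<in>{..<m}. h i (q i) \<ge> wgt (\<pi> i) t}))"

definition thr_set ::
  "nat \<Rightarrow> (nat \<Rightarrow> real \<Rightarrow> real) \<Rightarrow> (nat \<Rightarrow> real) \<Rightarrow> real \<Rightarrow> real \<Rightarrow> (nat \<Rightarrow> real) \<Rightarrow> real set" where
  "thr_set m h \<pi> t_up \<alpha> q = {t \<in> {0<..t_up}. fdp_hat m h \<pi> q t \<le> \<alpha>}"

definition rejected ::
  "nat \<Rightarrow> (nat \<Rightarrow> real \<Rightarrow> real) \<Rightarrow> (nat \<Rightarrow> real) \<Rightarrow> real \<Rightarrow> real \<Rightarrow> (nat \<Rightarrow> real) \<Rightarrow> nat \<Rightarrow> bool" where
  "rejected m h \<pi> t_up \<alpha> q i =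
     (thr_set m h \<pi> t_up \<alpha> q \<noteq> {} \<and> h i (q i) \<ge> wgt (\<pi> i) (Sup (thr_set m h \<pi> t_up \<alpha> q)))"

text \<open>False discovery proportion of the procedure; H i = 0 means null i is true.\<close>
definition fdp ::
  "nat \<Rightarrow> (nat \<Rightarrow> nat) \<Rightarrow> (nat \<Rightarrow> real \<Rightarrow> real) \<Rightarrow> (nat \<Rightarrow> real) \<Rightarrow> real \<Rightarrow> real \<Rightarrow> (nat \<Rightarrow> real) \<Rightarrow> real" where
  "fdp m H h \<pi> t_up \<alpha> q =
     (\<Sum>i<m. real (1 - H i) * (if rejected m h \<pi> t_up \<alpha> q i then 1 else 0))
     / max 1 (\<Sum>i<m. (if rejected m h \<pi> t_up \<alpha> q i then 1 else 0))"

end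

theory Submission
  imports Defs
begin

text \<open>
  Translate each p-value into the critical values \<open>L\<^sub>i\<close> and \<open>D\<^sub>i\<close> of \<open>t\<close> at which
  \<open>h\<^sub>i(p\<^sub>i) \<ge> w\<^sub>i(t)\<close> and \<open>h\<^sub>i(1 - p\<^sub>i) \<ge> w\<^sub>i(t)\<close> become true. For a null \<open>i\<close> let \<open>\<tau>\<^sub>i\<close> be the
  threshold obtained after replacing \<open>p\<^sub>i\<close> by \<open>0\<close>; it is independent of \<open>p\<^sub>i\<close>, and it equals the actual
  threshold whenever \<open>i\<close> is rejected. Hence, with \<open>V\<^sub>i\<close> the number of \<open>j \<noteq> i\<close> with \<open>D\<^sub>j < \<tau>\<^sub>i\<close>, almost
  surely \<open>FDP \<le> \<alpha> \<Sum>\<^sub>i 1{L\<^sub>i < \<tau>\<^sub>i} / (1 + V\<^sub>i)\<close>. Conditionally on the other p-values, the hypothesis on \<open>f\<^sub>0\<close>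
  bounds the expectation of the \<open>i\<close>th term by that of \<open>1{D\<^sub>i < \<tau>\<^sub>i} / (1 + V\<^sub>i)\<close>. Finally all \<open>\<tau>\<^sub>i\<close> with
  \<open>D\<^sub>i < \<tau>\<^sub>i\<close> coincide, so that these terms sum to at most \<open>1\<close>.
\<close>

definition count_below :: "nat set \<Rightarrow> (nat \<Rightarrow> real) \<Rightarrow> real \<Rightarrow> real" where
  "count_below I X e = real (card {j\<in>I. X j < e})"

definition feasible ::
  "real \<Rightarrow> real \<Rightarrow> nat set \<Rightarrow> (nat \<Rightarrow> real) \<Rightarrow> (nat \<Rightarrow> real) \<Rightarrow> real \<Rightarrow> bool" where
  "feasible \<alpha> r I L D e \<longleftrightarrow> 1 + count_below I D e \<le> \<alpha> * (r + count_below I L e)"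

text \<open>
  The estimated false discovery proportion is a right-continuous step function of \<open>t\<close>, so the supremum
  of the thresholds that meet the target need not be attained. Candidates are therefore the points
  where a mirrored p-value enters, with strict counts \<open>< e\<close>. Critical values above \<open>t_up\<close> are moved to
  the sentinel \<open>2\<close>, so \<open>e = 2\<close> represents \<open>t_up\<close> itself; \<open>0\<close> means that no candidate is
  feasible. The summand \<open>r\<close> counts rejections that are forced in addition to those in \<open>I\<close>.
\<close>
definition thr ::
  "real \<Rightarrow> real \<Rightarrow> nat set \<Rightarrow> (nat \<Rightarrow> real) \<Rightarrow> (nat \<Rightarrow> real) \<Rightarrow> real" where
  "thr \<alpha> r I L D =
     Max (insert (if feasible \<alpha> r I L D 2 then 2 else 0)
       ((\<lambda>j. if feasible \<alpha> r I L D (D j) then D j else 0) ` I))"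

abbreviation loo_thr :: "real \<Rightarrow> nat set \<Rightarrow> (nat \<Rightarrow> real) \<Rightarrow> (nat \<Rightarrow> real) \<Rightarrow> nat \<Rightarrow> real" where
  "loo_thr \<alpha> I L D i \<equiv> thr \<alpha> 1 (I - {i}) L D"

abbreviation loo_weight :: "real \<Rightarrow> nat set \<Rightarrow> (nat \<Rightarrow> real) \<Rightarrow> (nat \<Rightarrow> real) \<Rightarrow> nat \<Rightarrow> real" where
  "loo_weight \<alpha> I L D i \<equiv> 1 / (1 + count_below (I - {i}) D (loo_thr \<alpha> I L D i))"

lemma count_below_nonneg [simp]: "0 \<le> count_below I X e"
  by (simp add: count_below_def)

lemma count_below_eq_sum:
  "finite I \<Longrightarrow> count_below I X e = (\<Sum>j\<in>I. if X j < e then 1 else 0)"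
  by (simp add: count_below_def sum.If_cases Int_def)

lemma count_below_remove:
  assumes "finite I" "i \<in> I"
  shows "count_below I X e = (if X i < e then 1 else 0) + count_below (I - {i}) X e"
  using assms by (simp add: count_below_eq_sum sum.remove)

lemma thr_feasible:
  assumes "finite I" "0 < thr \<alpha> r I L D"
  shows "feasible \<alpha> r I L D (thr \<alpha> r I L D)" "thr \<alpha> r I L D \<in> insert 2 (D ` I)"
proof -
  let ?A = "insert (if feasible \<alpha> r I L D 2 then 2 else 0)
       ((\<lambda>j. if feasible \<alpha> r I L D (D j) then D j else 0) ` I)"
  have "thr \<alpha> r I L D \<in> ?A"
    unfolding thr_def using assms(1) by (intro Max_in) auto
  then show "feasible \<alpha> r I L D (thr \<alpha> r I L D)" "thr \<alpha> r I L D \<in> insert 2 (D ` I)"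
    using assms(2) by (auto split: if_splits)
qed

lemma thr_ge:
  assumes "finite I" "e \<in> insert 2 (D ` I)" "feasible \<alpha> r I L D e"
  shows "e \<le> thr \<alpha> r I L D"
  unfolding thr_def using assms by (intro Max_ge) force+

lemma thr_le_2:
  assumes "finite I" "\<And>j. j \<in> I \<Longrightarrow> D j \<le> 2"
  shows "thr \<alpha> r I L D \<le> 2"
  unfolding thr_def using assms by (subst Max_le_iff) auto

lemma loo_thr_eq_thr:
  assumes fin: "finite I" and i: "i \<in> I" "D i = 2" "0 < L i" "L i < thr \<alpha> 0 I L D"
    and D: "\<And>j. j \<in> I \<Longrightarrow> D j \<le> 2"
  shows "loo_thr \<alpha> I L D i = thr \<alpha> 0 I L D"
proof -
  let ?t = "thr \<alpha> 0 I L D" and ?t' = "loo_thr \<alpha> I L D i"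
  have fin': "finite (I - {i})" using fin by simp
  have same: "feasible \<alpha> 0 I L D e \<longleftrightarrow> feasible \<alpha> 1 (I - {i}) L D e"
    if "L i < e" "e \<le> 2" for e
    using that i by (simp add: feasible_def count_below_remove[OF fin i(1)])
  have t: "feasible \<alpha> 0 I L D ?t" "?t \<in> insert 2 (D ` I)"
    using thr_feasible[OF fin, of \<alpha> 0 L D] i by auto
  have t2: "?t \<le> 2" using thr_le_2[OF fin D] by simp
  have "?t \<in> insert 2 (D ` (I - {i}))" using t(2) i by auto
  then have le: "?t \<le> ?t'"
    using t(1) same[OF i(4) t2] by (intro thr_ge[OF fin']) auto
  have t': "feasible \<alpha> 1 (I - {i}) L D ?t'" "?t' \<in> insert 2 (D ` (I - {i}))"
    using thr_feasible[OF fin', of \<alpha> 1 L D] i le by auto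
  have "?t' \<le> 2" using thr_le_2[OF fin'] D by simp
  then have "?t' \<le> ?t"
    using t' same[of ?t'] le i by (intro thr_ge[OF fin]) auto
  with le show ?thesis by simp
qed

lemma sum_loo_weight_le_1:
  assumes fin: "finite I" and N: "N \<subseteq> I"
    and D: "\<And>j. j \<in> I \<Longrightarrow> 0 < D j \<and> D j \<le> 2"
    and LD: "\<And>i. i \<in> N \<Longrightarrow> L i = 2 \<or> D i = 2"
  shows "(\<Sum>i\<in>N. if D i < loo_thr \<alpha> I L D i then loo_weight \<alpha> I L D i else 0) \<le> 1"
proof -
  define A where "A = {i\<in>N. D i < loo_thr \<alpha> I L D i}"
  \<comment> \<open>For \<open>e > D i\<close> the leave-one-out condition becomes \<open>G e\<close>, which does not mention \<open>i\<close>.\<close>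
  define G where "G e \<longleftrightarrow> count_below I D e \<le> \<alpha> * (1 + count_below I L e)" for e
  define T where "T = Max {e \<in> insert 2 (D ` I). G e}"
  have finN: "finite N" using fin N finite_subset by blast
  have finG: "finite {e \<in> insert 2 (D ` I). G e}" using fin by simp
  have key: "loo_thr \<alpha> I L D i = T" if "i \<in> A" for i
  proof -
    let ?t = "loo_thr \<alpha> I L D i"
    have i: "i \<in> I" "D i < ?t" "i \<in> N" using that N by (auto simp: A_def)
    have fin': "finite (I - {i})" using fin by simp
    have t: "feasible \<alpha> 1 (I - {i}) L D ?t" "?t \<in> insert 2 (D ` (I - {i}))"
      using thr_feasible[OF fin', of \<alpha> 1 L D] i D[OF i(1)] by auto
    have t2: "?t \<le> 2" using thr_le_2[OF fin'] D by simp
    then have "L i = 2" using LD[OF i(3)] i by auto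
    then have same: "feasible \<alpha> 1 (I - {i}) L D e \<longleftrightarrow> G e" if "D i < e" "e \<le> 2" for e
      using that by (simp add: feasible_def G_def count_below_remove[OF fin i(1)])
    have tG: "?t \<in> {e \<in> insert 2 (D ` I). G e}"
      using t same[OF i(2) t2] by auto
    then have le: "?t \<le> T" unfolding T_def using finG by (intro Max_ge)
    have TG: "T \<in> {e \<in> insert 2 (D ` I). G e}"
      unfolding T_def using finG tG by (intro Max_in) auto
    have "T \<le> 2" using TG D by auto
    then have "T \<le> ?t"
      using TG same[of T] le i by (intro thr_ge[OF fin']) auto
    with le show ?thesis by simp
  qed
  have A_sub: "A \<subseteq> {j\<in>I. D j < T}"
  proof
    fix i assume i: "i \<in> A"
    then have "i \<in> I" "D i < loo_thr \<alpha> I L D i" using N by (auto simp: A_def)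
    with key[OF i] show "i \<in> {j\<in>I. D j < T}" by simp
  qed
  have "(\<Sum>i\<in>N. if D i < loo_thr \<alpha> I L D i then loo_weight \<alpha> I L D i else 0) =
        (\<Sum>i\<in>A. loo_weight \<alpha> I L D i)"
    unfolding A_def using finN by (simp add: sum.inter_filter)
  also have "\<dots> = (\<Sum>i\<in>A. 1 / count_below I D T)"
  proof (rule sum.cong)
    fix i assume "i \<in> A"
    moreover from this have "i \<in> I" "D i < T" using A_sub by auto
    ultimately show "loo_weight \<alpha> I L D i = 1 / count_below I D T"
      using key count_below_remove[OF fin \<open>i \<in> I\<close>, of D T] by simp
  qed simp
  also have "\<dots> = real (card A) / count_below I D T" by simp
  also have "\<dots> \<le> 1"
  proof -
    have "card A \<le> card {j\<in>I. D j < T}" using fin A_sub by (intro card_mono) auto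
    then show ?thesis by (auto simp: count_below_def divide_le_eq_1)
  qed
  finally show ?thesis .
qed

lemma fdp_le_loo_sum:
  fixes m :: nat and L D :: "nat \<Rightarrow> real"
  assumes u: "0 < u" "u < 1" and \<alpha>: "0 < \<alpha>" "\<alpha> < 1" and H01: "\<And>i. i < m \<Longrightarrow> H i \<in> {0, 1}"
    and L: "\<And>j. j < m \<Longrightarrow> 0 < L j \<and> (L j \<le> u \<or> L j = 2)"
    and D: "\<And>j. j < m \<Longrightarrow> 0 < D j \<and> (D j \<le> u \<or> D j = 2)"
    and Lw: "\<And>j t. j < m \<Longrightarrow> 0 < t \<Longrightarrow> t \<le> u \<Longrightarrow> h j (q j) \<ge> wgt (\<pi> j) t \<longleftrightarrow> L j \<le> t"
    and Dw: "\<And>j t. j < m \<Longrightarrow> 0 < t \<Longrightarrow> t \<le> u \<Longrightarrow> h j (1 - q j) \<ge> wgt (\<pi> j) t \<longleftrightarrow> D j \<le> t"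
    and LD: "\<And>i. i < m \<Longrightarrow> H i = 0 \<Longrightarrow> L i = 2 \<or> D i = 2"
    and ties: "\<And>i j. i < m \<Longrightarrow> H i = 0 \<Longrightarrow> j < m \<Longrightarrow> L i < 2 \<Longrightarrow> L i \<noteq> D j"
  shows "fdp m H h \<pi> u \<alpha> q \<le> \<alpha> * (\<Sum>i\<in>{i\<in>{..<m}. H i = 0}.
           if L i < loo_thr \<alpha> {..<m} L D i then loo_weight \<alpha> {..<m} L D i else 0)"
    (is "_ \<le> \<alpha> * ?S")
proof (cases "thr_set m h \<pi> u \<alpha> q = {}")
  case True
  then have "fdp m H h \<pi> u \<alpha> q = 0" by (simp add: fdp_def rejected_def)
  also have "0 \<le> \<alpha> * ?S"
    using \<alpha> by (intro mult_nonneg_nonneg sum_nonneg) (auto intro!: add_nonneg_nonneg)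
  finally show ?thesis .
next
  case False
  define N where "N = {i\<in>{..<m}. H i = 0}"
  define T where "T = thr_set m h \<pi> u \<alpha> q"
  define s where "s = Sup T"
  define \<tau> where "\<tau> = thr \<alpha> 0 {..<m} L D"
  have T_iff: "t \<in> T \<longleftrightarrow> 0 < t \<and> t \<le> u \<and>
      1 + real (card {j\<in>{..<m}. D j \<le> t}) \<le> \<alpha> * real (card {j\<in>{..<m}. L j \<le> t})" for t
  proof (cases "0 < t \<and> t \<le> u")
    case True
    have 1: "{i \<in> {..<m}. wgt (\<pi> i) t \<le> h i (1 - q i)} = {j\<in>{..<m}. D j \<le> t}"
      "{i \<in> {..<m}. wgt (\<pi> i) t \<le> h i (q i)} = {j\<in>{..<m}. L j \<le> t}"
      using True Lw Dw by auto
    show ?thesis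
    proof (cases "card {j\<in>{..<m}. L j \<le> t} = 0")
      case True
      have "\<not> 1 + real (card {j\<in>{..<m}. D j \<le> t}) \<le> \<alpha>" using \<alpha> by linarith
      moreover have "\<not> 1 + real (card {j\<in>{..<m}. D j \<le> t}) \<le> 0" by linarith
      ultimately show ?thesis
        unfolding T_def thr_set_def fdp_hat_def mem_Collect_eq 1 True by simp
    next
      case False
      then have pos: "1 \<le> real (card {j\<in>{..<m}. L j \<le> t})" by linarith
      then show ?thesis
        unfolding T_def thr_set_def fdp_hat_def mem_Collect_eq 1
        by (simp add: max_absorb2 pos_divide_le_eq)
    qed
  next
    case False
    then show ?thesis by (auto simp: T_def thr_set_def)
  qed
  have Tne: "T \<noteq> {}" using False by (simp add: T_def)
  have bdd: "bdd_above T" using T_iff by (intro bdd_aboveI[of _ u]) auto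
  have s_u: "s \<le> u" unfolding s_def using Tne T_iff by (intro cSup_least) auto
  have T_le_s: "t \<le> s" if "t \<in> T" for t
    unfolding s_def using that bdd by (intro cSup_upper)
  have s_pos: "0 < s" using Tne T_iff T_le_s by force
  have T_less: "t < \<tau>" if "t \<in> T" for t
  proof -
    define E where "E = insert 2 {e \<in> D ` {..<m}. t < e}"
    have finE: "finite E" "E \<noteq> {}" by (auto simp: E_def)
    define e where "e = Min E"
    have eE: "e \<in> E" unfolding e_def using finE by (rule Min_in)
    have te: "t < e" using eE that u by (auto simp: E_def T_iff)
    have "D j \<le> t" if "j < m" "D j < e" for j
    proof (rule ccontr)
      assume "\<not> D j \<le> t"
      then have "D j \<in> E" using that by (auto simp: E_def)
      then have "e \<le> D j" unfolding e_def using finE by (intro Min_le)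
      then show False using that by simp
    qed
    then have 1: "{j\<in>{..<m}. D j < e} = {j\<in>{..<m}. D j \<le> t}" using te by auto
    have "card {j\<in>{..<m}. L j \<le> t} \<le> card {j\<in>{..<m}. L j < e}"
      using te by (intro card_mono) auto
    then have "\<alpha> * real (card {j\<in>{..<m}. L j \<le> t}) \<le> \<alpha> * real (card {j\<in>{..<m}. L j < e})"
      using \<alpha> by (intro mult_left_mono) auto
    then have "feasible \<alpha> 0 {..<m} L D e"
      using that 1 by (simp add: feasible_def count_below_def T_iff)
    then have "e \<le> \<tau>" unfolding \<tau>_def using eE by (intro thr_ge) (auto simp: E_def)
    with te show ?thesis by simp
  qed
  have s_le: "s \<le> \<tau>"
    unfolding s_def using Tne T_less by (intro cSup_least) (auto intro: less_imp_le)
  have \<tau>_pos: "0 < \<tau>" using s_pos s_le by simp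
  have \<tau>: "feasible \<alpha> 0 {..<m} L D \<tau>" "\<tau> \<in> insert 2 (D ` {..<m})"
    using thr_feasible[of "{..<m}" \<alpha> 0 L D] \<tau>_pos by (auto simp: \<tau>_def)
  have \<tau>2: "\<tau> \<le> 2" unfolding \<tau>_def using D u by (intro thr_le_2) force+
  have cL_pos: "0 < count_below {..<m} L \<tau>"
  proof (rule ccontr)
    assume "\<not> 0 < count_below {..<m} L \<tau>"
    then have "count_below {..<m} L \<tau> = 0"
      using count_below_nonneg[of "{..<m}" L \<tau>] by linarith
    then show False
      using \<tau>(1) count_below_nonneg[of "{..<m}" D \<tau>] by (simp add: feasible_def)
  qed
  have L_le_s: "L j \<le> s" if "j < m" "L j < \<tau>" for j
  proof -
    define E where "E = {x \<in> L ` {..<m} \<union> D ` {..<m}. x < \<tau>}"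
    have finE: "finite E" by (simp add: E_def)
    have jE: "L j \<in> E" using that by (auto simp: E_def)
    define t where "t = Max E"
    have tE: "t \<in> E" unfolding t_def using finE jE by (intro Max_in) auto
    have ge: "x \<le> t" if "x \<in> E" for x unfolding t_def using finE that by (intro Max_ge)
    have t: "0 < t" "t \<le> u" "t < \<tau>" using tE L D \<tau>2 by (force simp: E_def)+
    have "{j\<in>{..<m}. D j \<le> t} = {j\<in>{..<m}. D j < \<tau>}" "{j\<in>{..<m}. L j \<le> t} = {j\<in>{..<m}. L j < \<tau>}"
      using t ge by (auto simp: E_def)
    then have "t \<in> T" using t \<tau>(1) by (simp add: T_iff feasible_def count_below_def)
    then show ?thesis using T_le_s ge jE by force
  qed
  have null_less: "L i < \<tau>" if "i \<in> N" "L i \<le> s" for i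
  proof -
    have "L i \<noteq> \<tau>"
      using that \<tau>(2) ties[of i] s_u u by (auto simp: N_def)
    then show ?thesis using that s_le by simp
  qed
  have rej: "rejected m h \<pi> u \<alpha> q j \<longleftrightarrow> L j \<le> s" if "j < m" for j
    using that Lw[of j s] s_pos s_u Tne by (simp add: rejected_def T_def s_def)
  have num: "(\<Sum>i<m. real (1 - H i) * (if rejected m h \<pi> u \<alpha> q i then 1 else 0)) =
      real (card {i\<in>N. L i < \<tau>})"
  proof -
    have "(\<Sum>i<m. real (1 - H i) * (if rejected m h \<pi> u \<alpha> q i then 1 else 0)) =
        (\<Sum>i<m. if H i = 0 \<and> L i < \<tau> then 1 else 0)"
    proof (rule sum.cong)
      fix i assume "i \<in> {..<m}"
      then show "real (1 - H i) * (if rejected m h \<pi> u \<alpha> q i then 1 else 0) =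
          (if H i = 0 \<and> L i < \<tau> then 1 else 0)"
        using H01[of i] null_less[of i] L_le_s[of i] rej[of i] by (auto simp: N_def)
    qed simp
    also have "\<dots> = real (card {i\<in>{..<m}. H i = 0 \<and> L i < \<tau>})"
      by (simp add: sum.If_cases Int_def)
    also have "{i\<in>{..<m}. H i = 0 \<and> L i < \<tau>} = {i\<in>N. L i < \<tau>}" by (auto simp: N_def)
    finally show ?thesis .
  qed
  have den: "count_below {..<m} L \<tau> \<le>
      max 1 (\<Sum>i<m. (if rejected m h \<pi> u \<alpha> q i then 1 else 0))"
  proof -
    have "count_below {..<m} L \<tau> \<le> (\<Sum>i<m. (if rejected m h \<pi> u \<alpha> q i then 1 else 0))"
      unfolding count_below_eq_sum[OF finite_lessThan]
      using rej L_le_s by (intro sum_mono) auto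
    then show ?thesis by simp
  qed
  have "fdp m H h \<pi> u \<alpha> q \<le> real (card {i\<in>N. L i < \<tau>}) / count_below {..<m} L \<tau>"
    unfolding fdp_def num using den cL_pos by (intro divide_left_mono) auto
  also have "\<dots> \<le> real (card {i\<in>N. L i < \<tau>}) * (\<alpha> / (1 + count_below {..<m} D \<tau>))"
  proof -
    have "0 < 1 + count_below {..<m} D \<tau>"
      using count_below_nonneg[of "{..<m}" D \<tau>] by linarith
    then have "1 / count_below {..<m} L \<tau> \<le> \<alpha> / (1 + count_below {..<m} D \<tau>)"
      using \<tau>(1) cL_pos by (simp add: feasible_def field_simps)
    then show ?thesis
      using mult_left_mono[of _ _ "real (card {i\<in>N. L i < \<tau>})"] by fastforce
  qed
  also have "\<dots> = \<alpha> * (\<Sum>i\<in>{i\<in>N. L i < \<tau>}. 1 / (1 + count_below {..<m} D \<tau>))"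
    by simp
  also have "\<dots> \<le> \<alpha> * ?S"
  proof (intro mult_left_mono)
    have "(\<Sum>i\<in>{i\<in>N. L i < \<tau>}. 1 / (1 + count_below {..<m} D \<tau>)) =
        (\<Sum>i\<in>N. if L i < \<tau> then 1 / (1 + count_below {..<m} D \<tau>) else 0)"
      by (rule sum.inter_filter) (simp add: N_def)
    also have "\<dots> \<le> ?S"
      unfolding N_def[symmetric]
    proof (rule sum_mono)
      fix i assume i: "i \<in> N"
      show "(if L i < \<tau> then 1 / (1 + count_below {..<m} D \<tau>) else 0) \<le>
        (if L i < loo_thr \<alpha> {..<m} L D i then loo_weight \<alpha> {..<m} L D i else 0)"
      proof (cases "L i < \<tau>")
        case True
        have im: "i \<in> {..<m}" using i by (simp add: N_def)
        have Di: "D i = 2" using LD[of i] i True \<tau>2 by (auto simp: N_def)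
        have "loo_thr \<alpha> {..<m} L D i = \<tau>"
          unfolding \<tau>_def using im Di L[of i] True D u
          by (intro loo_thr_eq_thr) (force simp: \<tau>_def)+
        then show ?thesis
          using True count_below_remove[OF finite_lessThan im, of D \<tau>] Di \<tau>2 by simp
      qed (auto intro!: add_nonneg_nonneg)
    qed
    finally show "(\<Sum>i\<in>{i\<in>N. L i < \<tau>}. 1 / (1 + count_below {..<m} D \<tau>)) \<le> ?S" .
  qed (use \<alpha> in simp)
  finally show ?thesis .
qed

text \<open>Clamping the argument to \<open>[0, 1]\<close> makes \<open>crit\<close> monotone, hence measurable, on the whole line.\<close>
definition crit :: "(real \<Rightarrow> real) \<Rightarrow> real \<Rightarrow> real \<Rightarrow> real \<Rightarrow> real" where
  "crit h \<pi> u x =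
     (let c = \<pi> / (\<pi> + (1 - \<pi>) * h (max 0 (min 1 x))) in if c \<le> u then c else 2)"

locale score =
  fixes h :: "real \<Rightarrow> real" and \<pi> u :: real
  assumes nonneg: "\<And>x. x \<in> {0..1} \<Longrightarrow> 0 \<le> h x"
    and decr: "\<And>x y. x \<in> {0..1} \<Longrightarrow> y \<in> {0..1} \<Longrightarrow> x < y \<Longrightarrow> h y < h x"
    and \<pi>: "0 < \<pi>" "\<pi> < 1" and u: "0 < u" "u < 1"
begin

lemma denom_pos: "x \<in> {0..1} \<Longrightarrow> 0 < \<pi> + (1 - \<pi>) * h x"
  using nonneg \<pi> by (simp add: add_pos_nonneg)

lemma crit_range: "0 < crit h \<pi> u x \<and> (crit h \<pi> u x \<le> u \<or> crit h \<pi> u x = 2)"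
  using \<pi> denom_pos[of "max 0 (min 1 x)"] by (simp add: crit_def Let_def)

lemma crit_le_2: "crit h \<pi> u x \<le> 2"
  using crit_range[of x] u by auto

lemma wgt_le_iff:
  assumes "x \<in> {0..1}" "0 < t" "t \<le> u"
  shows "wgt \<pi> t \<le> h x \<longleftrightarrow> crit h \<pi> u x \<le> t"
proof -
  have "wgt \<pi> t \<le> h x \<longleftrightarrow> (1 - t) * \<pi> \<le> h x * (t * (1 - \<pi>))"
    unfolding wgt_def using assms \<pi> by (intro pos_divide_le_eq) simp
  also have "\<dots> \<longleftrightarrow> \<pi> \<le> t * (\<pi> + (1 - \<pi>) * h x)" by (simp add: algebra_simps)
  also have "\<dots> \<longleftrightarrow> \<pi> / (\<pi> + (1 - \<pi>) * h x) \<le> t"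
    using denom_pos[OF assms(1)] by (simp add: pos_divide_le_eq)
  also have "\<dots> \<longleftrightarrow> crit h \<pi> u x \<le> t"
    using assms u by (auto simp: crit_def Let_def)
  finally show ?thesis .
qed

lemma antimono:
  assumes "x \<in> {0..1}" "y \<in> {0..1}" "x \<le> y"
  shows "h y \<le> h x"
  using assms decr[of x y] by (cases "x = y") auto

lemma mono_crit: "mono (crit h \<pi> u)"
proof
  fix x y :: real assume "x \<le> y"
  let ?x = "max 0 (min 1 x)" and ?y = "max 0 (min 1 y)"
  have "h ?y \<le> h ?x" using \<open>x \<le> y\<close> by (intro antimono) auto
  then have "\<pi> / (\<pi> + (1 - \<pi>) * h ?x) \<le> \<pi> / (\<pi> + (1 - \<pi>) * h ?y)"
    using \<pi> denom_pos[of ?x] denom_pos[of ?y]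
    by (intro divide_left_mono add_left_mono mult_left_mono mult_pos_pos) auto
  then show "crit h \<pi> u x \<le> crit h \<pi> u y"
    using u by (auto simp: crit_def Let_def)
qed

lemma borel_measurable_crit [measurable]: "crit h \<pi> u \<in> borel_measurable borel"
  by (intro borel_measurable_mono mono_crit)

lemma crit_inj:
  assumes "x \<in> {0..1}" "y \<in> {0..1}" "crit h \<pi> u x = crit h \<pi> u y" "crit h \<pi> u x < 2"
  shows "x = y"
proof -
  have "\<pi> / (\<pi> + (1 - \<pi>) * h x) = \<pi> / (\<pi> + (1 - \<pi>) * h y)"
    using assms by (auto simp: crit_def Let_def split: if_splits)
  then have "h x = h y"
    using \<pi> by simp
  then show ?thesis
    using decr[of x y] decr[of y x] assms by (cases x y rule: linorder_cases) auto
qed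

lemma crit_less_2_imp_le_half:
  assumes "h (1/2) \<le> wgt \<pi> u" "x \<in> {0..1}" "crit h \<pi> u x < 2"
  shows "x \<le> 1/2"
proof (rule ccontr)
  assume "\<not> x \<le> 1/2"
  then have "h x < h (1/2)" using decr[of "1/2" x] assms by auto
  moreover have "wgt \<pi> u \<le> h x"
    using wgt_le_iff[OF assms(2), of u] crit_range[of x] assms(3) u by auto
  ultimately show False using assms(1) by simp
qed

end

lemma measurable_count_below:
  assumes "finite I" and [measurable]: "\<And>j. j \<in> I \<Longrightarrow> X j \<in> borel_measurable N"
    and [measurable]: "e \<in> borel_measurable N"
  shows "(\<lambda>x. count_below I (\<lambda>j. X j x) (e x)) \<in> borel_measurable N"
  unfolding count_below_eq_sum[OF assms(1)] by measurable

lemma measurable_thr: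
  assumes I: "finite I" and L [measurable]: "\<And>j. j \<in> I \<Longrightarrow> L j \<in> borel_measurable N"
    and D [measurable]: "\<And>j. j \<in> I \<Longrightarrow> D j \<in> borel_measurable N"
  shows "(\<lambda>x. thr \<alpha> r I (\<lambda>j. L j x) (\<lambda>j. D j x)) \<in> borel_measurable N"
proof -
  have if_meas: "(\<lambda>x. if feasible \<alpha> r I (\<lambda>j. L j x) (\<lambda>j. D j x) (e x) then e x else 0) \<in> borel_measurable N"
    if [measurable]: "e \<in> borel_measurable N" for e
  proof -
    note measurable_count_below[OF I L that, measurable] measurable_count_below[OF I D that, measurable]
    show ?thesis unfolding feasible_def by measurable
  qed
  show ?thesis
  proof (cases "I = {}")
    case True
    then show ?thesis using if_meas[of "\<lambda>_. 2"] by (simp add: thr_def)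
  next
    case False
    then have "thr \<alpha> r I (\<lambda>j. L j x) (\<lambda>j. D j x) =
       max (if feasible \<alpha> r I (\<lambda>j. L j x) (\<lambda>j. D j x) 2 then 2 else 0)
       (Max ((\<lambda>j. if feasible \<alpha> r I (\<lambda>j. L j x) (\<lambda>j. D j x) (D j x) then D j x else 0) ` I))" for x
      unfolding thr_def using I by (subst Max_insert) auto
    then show ?thesis
      using I by (simp only:) (intro borel_measurable_max borel_measurable_Max if_meas D; simp)
  qed
qed

lemma count_below_cong:
  "(\<And>j. j \<in> I \<Longrightarrow> X j = Y j) \<Longrightarrow> count_below I X e = count_below I Y e"
  by (auto simp: count_below_def intro!: arg_cong[where f=card])

lemma thr_cong:
  assumes "\<And>j. j \<in> I \<Longrightarrow> L j = L' j" "\<And>j. j \<in> I \<Longrightarrow> D j = D' j"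
  shows "thr \<alpha> r I L D = thr \<alpha> r I L' D'"
proof -
  have "feasible \<alpha> r I L D e = feasible \<alpha> r I L' D' e" for e
    using count_below_cong[of I L L' e] count_below_cong[of I D D' e] assms
    by (simp add: feasible_def)
  then have "(\<lambda>j. if feasible \<alpha> r I L D (D j) then D j else 0) ` I =
      (\<lambda>j. if feasible \<alpha> r I L' D' (D' j) then D' j else 0) ` I"
    "feasible \<alpha> r I L D 2 = feasible \<alpha> r I L' D' 2"
    using assms(2) by (simp_all cong: image_cong_simp if_cong)
  then show ?thesis unfolding thr_def by (simp only:)
qed

lemma (in prob_space) indep_var_nn_integral_mono:
  fixes f g :: "'b \<times> 'b \<Rightarrow> ennreal"
  assumes ind: "indep_var S X T Y"
    and f [measurable]: "f \<in> borel_measurable (S \<Otimes>\<^sub>M T)"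
    and g [measurable]: "g \<in> borel_measurable (S \<Otimes>\<^sub>M T)"
    and le: "\<And>y. y \<in> space T \<Longrightarrow> (\<integral>\<^sup>+ \<omega>. f (X \<omega>, y) \<partial>M) \<le> (\<integral>\<^sup>+ \<omega>. g (X \<omega>, y) \<partial>M)"
  shows "(\<integral>\<^sup>+ \<omega>. f (X \<omega>, Y \<omega>) \<partial>M) \<le> (\<integral>\<^sup>+ \<omega>. g (X \<omega>, Y \<omega>) \<partial>M)"
proof -
  have X [measurable]: "X \<in> measurable M S" and Y [measurable]: "Y \<in> measurable M T"
    and eq: "distr M S X \<Otimes>\<^sub>M distr M T Y = distr M (S \<Otimes>\<^sub>M T) (\<lambda>x. (X x, Y x))"
    using ind unfolding indep_var_distribution_eq by auto
  interpret PX: prob_space "distr M S X" by (rule prob_space_distr) fact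
  interpret PY: prob_space "distr M T Y" by (rule prob_space_distr) fact
  interpret pair_sigma_finite "distr M S X" "distr M T Y" ..
  have F: "(\<integral>\<^sup>+ \<omega>. k (X \<omega>, Y \<omega>) \<partial>M) = (\<integral>\<^sup>+ y. (\<integral>\<^sup>+ \<omega>. k (X \<omega>, y) \<partial>M) \<partial>distr M T Y)"
    if k [measurable]: "k \<in> borel_measurable (S \<Otimes>\<^sub>M T)" for k :: "'b \<times> 'b \<Rightarrow> ennreal"
  proof -
    have "(\<integral>\<^sup>+ \<omega>. k (X \<omega>, Y \<omega>) \<partial>M) = (\<integral>\<^sup>+ z. k z \<partial>(distr M S X \<Otimes>\<^sub>M distr M T Y))"
      unfolding eq by (subst nn_integral_distr) auto
    also have "\<dots> = (\<integral>\<^sup>+ y. (\<integral>\<^sup>+ x. k (x, y) \<partial>distr M S X) \<partial>distr M T Y)"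
      by (rule nn_integral_snd[symmetric]) simp
    also have "\<dots> = (\<integral>\<^sup>+ y. (\<integral>\<^sup>+ \<omega>. k (X \<omega>, y) \<partial>M) \<partial>distr M T Y)"
      by (intro nn_integral_cong nn_integral_distr) auto
    finally show ?thesis .
  qed
  show ?thesis
    unfolding F[OF f] F[OF g] using le by (rule nn_integral_mono) simp
qed

lemma nn_integral_mirror_le:
  fixes f :: "real \<Rightarrow> ennreal" and c :: "real \<Rightarrow> real"
  assumes [measurable]: "f \<in> borel_measurable lborel"
    and supp: "\<And>x. x \<notin> {0..1} \<Longrightarrow> f x = 0"
    and cond: "\<And>a. a \<in> {0..1} \<Longrightarrow> (\<integral>\<^sup>+ x\<in>{0..a}. f x \<partial>lborel) \<le> (\<integral>\<^sup>+ x\<in>{1-a..1}. f x \<partial>lborel)"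
    and mono: "mono c"
  shows "(\<integral>\<^sup>+ x. f x * indicator {x. c x < s} x \<partial>lborel)
       \<le> (\<integral>\<^sup>+ x. f x * indicator {x. c (1 - x) < s} x \<partial>lborel)"
proof (cases "{x\<in>{0..1}. c x < s} = {}")
  case True
  then have "f x * indicator {x. c x < s} x = 0" for x
    using supp[of x] by (cases "x \<in> {0..1}") (auto simp: indicator_def)
  then show ?thesis by (simp only: nn_integral_const) simp
next
  case False
  define A where "A = {x\<in>{0..1}. c x < s}"
  define a where "a = Sup A"
  have bdd: "bdd_above A" by (rule bdd_aboveI[of _ 1]) (auto simp: A_def)
  have Ane: "A \<noteq> {}" using False by (simp add: A_def)
  have le_a: "x \<le> a" if "x \<in> A" for x unfolding a_def using that bdd by (rule cSup_upper)
  have a01: "a \<in> {0..1}"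
  proof -
    have "a \<le> 1" unfolding a_def using Ane by (intro cSup_least) (auto simp: A_def)
    moreover obtain x where "x \<in> A" using Ane by auto
    ultimately show ?thesis using le_a[of x] by (auto simp: A_def)
  qed
  have below: "c x < s" if "x < a" for x
  proof -
    obtain y where "y \<in> A" "x < y" using less_cSup_iff[OF Ane bdd, of x] \<open>x < a\<close> by (auto simp: a_def)
    then show ?thesis using monoD[OF mono, of x y] by (auto simp: A_def)
  qed
  have "(\<integral>\<^sup>+ x. f x * indicator {x. c x < s} x \<partial>lborel) \<le> (\<integral>\<^sup>+ x\<in>{0..a}. f x \<partial>lborel)"
  proof (intro nn_integral_mono)
    fix x show "f x * indicator {x. c x < s} x \<le> f x * indicator {0..a} x"
      using supp[of x] le_a[of x] by (cases "x \<in> {0..1}") (auto simp: indicator_def A_def)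
  qed
  also have "\<dots> \<le> (\<integral>\<^sup>+ x\<in>{1-a..1}. f x \<partial>lborel)" by (rule cond[OF a01])
  also have "\<dots> \<le> (\<integral>\<^sup>+ x. f x * indicator {x. c (1 - x) < s} x \<partial>lborel)"
  proof (intro nn_integral_mono_AE)
    show "AE x in lborel. f x * indicator {1-a..1} x \<le> f x * indicator {x. c (1 - x) < s} x"
      using AE_lborel_singleton[of "1 - a"]
    proof eventually_elim
      case (elim x)
      then show ?case using below[of "1 - x"] by (auto simp: indicator_def)
    qed
  qed
  finally show ?thesis .
qed

lemma distributed_lborel_AE_neq:
  assumes "distributed M lborel X f"
  shows "AE \<omega> in M. X \<omega> \<noteq> (a :: real)"
proof -
  have f [measurable]: "f \<in> borel_measurable lborel" and X [measurable]: "X \<in> measurable M lborel"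
    using assms by (auto simp: distributed_def)
  have "AE x in density lborel f. x \<noteq> a"
    using AE_lborel_singleton[of a] by (subst AE_density) auto
  then have "AE x in distr M lborel X. x \<noteq> a"
    unfolding distributed_distr_eq_density[OF assms] .
  then show ?thesis using X by (subst (asm) AE_distr_iff) auto
qed

theorem theorem1:
  fixes M :: "'a measure" and m :: nat and p :: "nat \<Rightarrow> 'a \<Rightarrow> real"
    and H :: "nat \<Rightarrow> nat" and f0 :: "real \<Rightarrow> real"
    and h :: "nat \<Rightarrow> real \<Rightarrow> real" and \<pi> :: "nat \<Rightarrow> real"
    and t_up \<alpha> :: real
  assumes "prob_space M"
    and H01: "\<forall>i<m. H i \<in> {0, 1}"
    and rv: "\<forall>i<m. p i \<in> borel_measurable M"
    and pval: "\<forall>i<m. AE \<omega> in M. p i \<omega> \<in> {0..1}"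
    and indep: "prob_space.indep_vars M (\<lambda>_. borel) p {..<m}"
    and f0_meas: "f0 \<in> borel_measurable lborel"
    and f0_nonneg: "\<forall>x. f0 x \<ge> 0"
    and f0_supp: "\<forall>x. x \<notin> {0..1} \<longrightarrow> f0 x = 0"
    and null_dens: "\<forall>i<m. H i = 0 \<longrightarrow> distributed M lborel (p i) (\<lambda>x. ennreal (f0 x))"
    and f0_cond: "\<forall>a\<in>{0..1}. (\<integral>\<^sup>+ u\<in>{0..a}. ennreal (f0 u) \<partial>lborel)
                                \<le> (\<integral>\<^sup>+ u\<in>{1-a..1}. ennreal (f0 u) \<partial>lborel)"
    and h_nonneg: "\<forall>i<m. \<forall>x\<in>{0..1}. h i x \<ge> 0"
    and h_decr: "\<forall>i<m. \<forall>x\<in>{0..1}. \<forall>y\<in>{0..1}. x < y \<longrightarrow> h i y < h i x"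
    and pi_range: "\<forall>i<m. 0 < \<pi> i \<and> \<pi> i < 1"
    and t_up_range: "0 < t_up" "t_up < 1"
    and t_up_w: "\<forall>i<m. wgt (\<pi> i) t_up \<ge> h i (1/2)"
    and alpha_range: "0 < \<alpha>" "\<alpha> < 1"
  shows "prob_space.expectation M (\<lambda>\<omega>. fdp m H h \<pi> t_up \<alpha> (\<lambda>i. p i \<omega>)) \<le> \<alpha>"
proof -
  interpret prob_space M by fact
  define c where "c j = crit (h j) (\<pi> j) t_up" for j
  have sc: "score (h j) (\<pi> j) t_up" if "j < m" for j
    using that h_nonneg h_decr pi_range t_up_range by unfold_locales auto
  note c_range = score.crit_range[OF sc, folded c_def]
  note c_le_2 = score.crit_le_2[OF sc, folded c_def]
  note c_mono = score.mono_crit[OF sc, folded c_def]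
  have c_meas [measurable]: "c j \<in> borel_measurable borel" if "j < m" for j
    using score.borel_measurable_crit[OF sc[OF that]] by (simp add: c_def)
  define L where "L \<omega> j = c j (p j \<omega>)" for \<omega> j
  define D where "D \<omega> j = c j (1 - p j \<omega>)" for \<omega> j
  define \<tau> where "\<tau> i y = loo_thr \<alpha> {..<m} (\<lambda>j. c j (y j)) (\<lambda>j. c j (1 - y j)) i" for i and y :: "nat \<Rightarrow> real"
  define W where "W i y = loo_weight \<alpha> {..<m} (\<lambda>j. c j (y j)) (\<lambda>j. c j (1 - y j)) i" for i and y :: "nat \<Rightarrow> real"
  define P where "P \<omega> = (\<lambda>j. p j \<omega>)" for \<omega>
  define N where "N = {i\<in>{..<m}. H i = 0}"
  define lo where "lo i \<omega> = (if L \<omega> i < \<tau> i (P \<omega>) then W i (P \<omega>) else 0)" for i \<omega>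
  define hi where "hi i \<omega> = (if D \<omega> i < \<tau> i (P \<omega>) then W i (P \<omega>) else 0)" for i \<omega>
  have \<tau>_restrict: "\<tau> i (restrict y ({..<m} - {i})) = \<tau> i y" for i y
    unfolding \<tau>_def by (intro thr_cong) auto
  have W_restrict: "W i (restrict y ({..<m} - {i})) = W i y" for i y
    unfolding W_def using \<tau>_restrict[of i y, unfolded \<tau>_def]
      count_below_cong[of "{..<m} - {i}" "\<lambda>j. c j (1 - restrict y ({..<m} - {i}) j)" "\<lambda>j. c j (1 - y j)"]
    by simp
  have W01: "0 \<le> W i y" "W i y \<le> 1" for i y
    unfolding W_def by (auto intro!: add_nonneg_nonneg simp: divide_le_eq_1 add_pos_nonneg)
  have \<tau>_meas [measurable]: "\<tau> i \<in> borel_measurable (PiM ({..<m} - {i}) (\<lambda>_. borel))" for i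
    unfolding \<tau>_def by (intro measurable_thr) auto
  have W_meas [measurable]: "W i \<in> borel_measurable (PiM ({..<m} - {i}) (\<lambda>_. borel))" for i
  proof -
    have "(\<lambda>y. count_below ({..<m} - {i}) (\<lambda>j. c j (1 - y j)) (\<tau> i y))
        \<in> borel_measurable (PiM ({..<m} - {i}) (\<lambda>_. borel))"
      by (intro measurable_count_below) auto
    then show ?thesis unfolding W_def \<tau>_def[symmetric] by measurable
  qed
  have ind: "indep_var (PiM {i} (\<lambda>_. borel)) (\<lambda>\<omega>. restrict (P \<omega>) {i})
      (PiM ({..<m} - {i}) (\<lambda>_. borel)) (\<lambda>\<omega>. restrict (P \<omega>) ({..<m} - {i}))" if "i < m" for i
    unfolding P_def using that by (intro indep_var_restrict[OF indep]) auto
  have p_meas [measurable]: "p j \<in> borel_measurable M" if "j < m" for j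
    using rv that by simp
  have P_meas [measurable]: "(\<lambda>\<omega>. restrict (P \<omega>) ({..<m} - {i})) \<in> measurable M (PiM ({..<m} - {i}) (\<lambda>_. borel))" for i
    unfolding P_def by (intro measurable_restrict) auto
  have dist: "distributed M lborel (p i) (\<lambda>x. ennreal (f0 x))" if "i \<in> N" for i
    using that null_dens by (simp add: N_def)

  have lo_hi_meas [measurable]: "lo i \<in> borel_measurable M" "hi i \<in> borel_measurable M" if "i \<in> N" for i
  proof -
    have [measurable]: "i < m" using that by (simp add: N_def)
    have [measurable]: "(\<lambda>\<omega>. \<tau> i (P \<omega>)) \<in> borel_measurable M" "(\<lambda>\<omega>. W i (P \<omega>)) \<in> borel_measurable M"
      using measurable_compose[OF P_meas \<tau>_meas] measurable_compose[OF P_meas W_meas]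
      by (simp_all add: \<tau>_restrict W_restrict)
    have [measurable]: "c i \<in> borel_measurable borel" "p i \<in> borel_measurable M"
      using \<open>i < m\<close> by simp_all
    show "lo i \<in> borel_measurable M" "hi i \<in> borel_measurable M"
      unfolding lo_def hi_def L_def D_def by measurable
  qed
  have lo_hi_nonneg: "0 \<le> lo i \<omega>" "0 \<le> hi i \<omega>" for i \<omega>
    using W01 by (auto simp: lo_def hi_def)
  have lo_hi_int: "integrable M (lo i)" "integrable M (hi i)" if "i \<in> N" for i
    using that W01 by (auto intro!: integrable_const_bound[where B=1] simp: lo_def hi_def)

  have swap: "expectation (lo i) \<le> expectation (hi i)" if i: "i \<in> N" for i
  proof -
    have im: "i < m" using i by (simp add: N_def)
    note [measurable] = c_meas[OF im]
    define f where "f = (\<lambda>(x, y). ennreal (if c i (x i) < \<tau> i y then W i y else 0))"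
    define g where "g = (\<lambda>(x, y). ennreal (if c i (1 - x i) < \<tau> i y then W i y else 0))"
    have "(\<integral>\<^sup>+ \<omega>. f (restrict (P \<omega>) {i}, restrict (P \<omega>) ({..<m} - {i})) \<partial>M)
        \<le> (\<integral>\<^sup>+ \<omega>. g (restrict (P \<omega>) {i}, restrict (P \<omega>) ({..<m} - {i})) \<partial>M)"
    proof (rule indep_var_nn_integral_mono[OF ind[OF im]])
      show "f \<in> borel_measurable (PiM {i} (\<lambda>_. borel) \<Otimes>\<^sub>M PiM ({..<m} - {i}) (\<lambda>_. borel))"
        "g \<in> borel_measurable (PiM {i} (\<lambda>_. borel) \<Otimes>\<^sub>M PiM ({..<m} - {i}) (\<lambda>_. borel))"
        unfolding f_def g_def by measurable
      fix y :: "nat \<Rightarrow> real"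
      have eq: "(\<integral>\<^sup>+ \<omega>. ennreal (if d (p i \<omega>) < \<tau> i y then W i y else 0) \<partial>M) =
          ennreal (W i y) * (\<integral>\<^sup>+ x. ennreal (f0 x) * indicator {x. d x < \<tau> i y} x \<partial>lborel)"
        if [measurable]: "d \<in> borel_measurable borel" for d :: "real \<Rightarrow> real"
      proof -
        have "(\<integral>\<^sup>+ \<omega>. ennreal (if d (p i \<omega>) < \<tau> i y then W i y else 0) \<partial>M) =
            (\<integral>\<^sup>+ x. ennreal (f0 x) * ennreal (if d x < \<tau> i y then W i y else 0) \<partial>lborel)"
          by (rule distributed_nn_integral[OF dist[OF i], symmetric]) simp
        also have "\<dots> = (\<integral>\<^sup>+ x. ennreal (W i y) * (ennreal (f0 x) * indicator {x. d x < \<tau> i y} x) \<partial>lborel)"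
          by (intro nn_integral_cong) (auto simp: indicator_def mult.commute)
        also have "\<dots> = ennreal (W i y) * (\<integral>\<^sup>+ x. ennreal (f0 x) * indicator {x. d x < \<tau> i y} x \<partial>lborel)"
          using f0_meas by (intro nn_integral_cmult) simp
        finally show ?thesis .
      qed
      have "(\<integral>\<^sup>+ x. ennreal (f0 x) * indicator {x. c i x < \<tau> i y} x \<partial>lborel)
          \<le> (\<integral>\<^sup>+ x. ennreal (f0 x) * indicator {x. c i (1 - x) < \<tau> i y} x \<partial>lborel)"
        using f0_meas f0_supp f0_cond c_mono[OF im] by (intro nn_integral_mirror_le) auto
      then show "(\<integral>\<^sup>+ \<omega>. f (restrict (P \<omega>) {i}, y) \<partial>M) \<le> (\<integral>\<^sup>+ \<omega>. g (restrict (P \<omega>) {i}, y) \<partial>M)"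
        using eq[of "c i"] eq[of "\<lambda>x. c i (1 - x)"]
        by (simp add: f_def g_def P_def mult_left_mono)
    qed
    then have "(\<integral>\<^sup>+ \<omega>. ennreal (lo i \<omega>) \<partial>M) \<le> (\<integral>\<^sup>+ \<omega>. ennreal (hi i \<omega>) \<partial>M)"
      by (simp add: f_def g_def lo_def hi_def \<tau>_restrict W_restrict L_def D_def P_def cong: if_cong)
    moreover have "(\<integral>\<^sup>+ \<omega>. ennreal (lo i \<omega>) \<partial>M) = ennreal (expectation (lo i))"
      "(\<integral>\<^sup>+ \<omega>. ennreal (hi i \<omega>) \<partial>M) = ennreal (expectation (hi i))"
      using lo_hi_int[OF i] lo_hi_nonneg by (auto intro!: nn_integral_eq_integral)
    moreover have "0 \<le> expectation (hi i)"
      using lo_hi_nonneg by (intro integral_nonneg_AE) auto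
    ultimately show ?thesis by simp
  qed

  have AE_ties: "AE \<omega> in M. \<not> (p i \<omega> \<in> {0..1} \<and> p j \<omega> \<in> {0..1} \<and> L \<omega> i < 2 \<and> L \<omega> i = D \<omega> j)"
    if i: "i \<in> N" and j: "j < m" "j \<noteq> i" for i j
  proof -
    have im: "i < m" using i by (simp add: N_def)
    note [measurable] = c_meas[OF im] c_meas[OF j(1)] p_meas[OF im] p_meas[OF j(1)]
    have jm: "j \<in> {..<m} - {i}" using j by simp
    define f where "f = (\<lambda>(x, y). if x i \<in> {0..1} \<and> y j \<in> {0..1} \<and> c i (x i) < 2 \<and> c i (x i) = c j (1 - y j)
      then 1 else 0 :: ennreal)"
    have "(\<integral>\<^sup>+ \<omega>. f (restrict (P \<omega>) {i}, restrict (P \<omega>) ({..<m} - {i})) \<partial>M) \<le> (\<integral>\<^sup>+ \<omega>. 0 \<partial>M)"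
    proof (rule indep_var_nn_integral_mono[OF ind[OF im], where g="\<lambda>_. 0"])
      let ?S = "PiM {i} (\<lambda>_. borel) \<Otimes>\<^sub>M PiM ({..<m} - {i}) (\<lambda>_. borel) :: ((nat \<Rightarrow> real) \<times> (nat \<Rightarrow> real)) measure"
      have [measurable]: "(\<lambda>z. fst z i) \<in> borel_measurable ?S" "(\<lambda>z. snd z j) \<in> borel_measurable ?S"
        using jm by (auto intro!: measurable_compose[OF measurable_fst] measurable_compose[OF measurable_snd])
      have [measurable]: "(\<lambda>z. c i (fst z i)) \<in> borel_measurable ?S"
        by (rule measurable_compose[OF _ c_meas[OF im]]) measurable
      have [measurable]: "(\<lambda>z. c j (1 - snd z j)) \<in> borel_measurable ?S"
        by (rule measurable_compose[OF _ c_meas[OF j(1)]]) measurable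
      show "f \<in> borel_measurable ?S"
        unfolding f_def split_beta' by measurable
      fix y :: "nat \<Rightarrow> real"
      have "AE \<omega> in M. f (restrict (P \<omega>) {i}, y) = 0"
      proof (cases "\<exists>x. x \<in> {0..1} \<and> c i x < 2 \<and> c i x = c j (1 - y j)")
        case True
        then obtain x where x: "x \<in> {0..1}" "c i x < 2" "c i x = c j (1 - y j)" by auto
        show ?thesis
          using distributed_lborel_AE_neq[OF dist[OF i], of x]
        proof eventually_elim
          case (elim \<omega>)
          then show ?case
            using score.crit_inj[OF sc[OF im] x(1), of "p i \<omega>"] x by (auto simp: f_def P_def c_def)
        qed
      next
        case False
        then show ?thesis by (auto simp: f_def P_def)
      qed
      then have "(\<integral>\<^sup>+ \<omega>. f (restrict (P \<omega>) {i}, y) \<partial>M) = (\<integral>\<^sup>+ \<omega>. 0 \<partial>M)"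
        by (rule nn_integral_cong_AE)
      then show "(\<integral>\<^sup>+ \<omega>. f (restrict (P \<omega>) {i}, y) \<partial>M) \<le> (\<integral>\<^sup>+ \<omega>. 0 \<partial>M)" by simp
    qed simp
    then have "(\<integral>\<^sup>+ \<omega>. (if p i \<omega> \<in> {0..1} \<and> p j \<omega> \<in> {0..1} \<and> c i (p i \<omega>) < 2 \<and>
        c i (p i \<omega>) = c j (1 - p j \<omega>) then 1 else 0) \<partial>M) = 0"
      using j by (simp add: f_def P_def)
    then have "AE \<omega> in M. (if p i \<omega> \<in> {0..1} \<and> p j \<omega> \<in> {0..1} \<and> c i (p i \<omega>) < 2 \<and>
        c i (p i \<omega>) = c j (1 - p j \<omega>) then 1 else 0 :: ennreal) = 0"
      by (subst (asm) nn_integral_0_iff_AE) simp_all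
    then show ?thesis by eventually_elim (auto simp: L_def D_def split: if_splits)
  qed

  have AE_01: "AE \<omega> in M. \<forall>i\<in>{..<m}. p i \<omega> \<in> {0..1}"
    using pval by (intro AE_finite_allI) auto
  have AE_half: "AE \<omega> in M. \<forall>i\<in>N. p i \<omega> \<noteq> 1/2"
    by (intro AE_finite_allI distributed_lborel_AE_neq[OF dist]) (simp_all add: N_def)
  have AE_noties: "AE \<omega> in M. \<forall>i\<in>N. \<forall>j\<in>{..<m} - {i}.
      \<not> (p i \<omega> \<in> {0..1} \<and> p j \<omega> \<in> {0..1} \<and> L \<omega> i < 2 \<and> L \<omega> i = D \<omega> j)"
    using AE_ties by (intro AE_finite_allI) (auto simp: N_def)
  have LD_2: "L \<omega> i = 2 \<or> D \<omega> i = 2" if "i \<in> N" "p i \<omega> \<in> {0..1}" "p i \<omega> \<noteq> 1/2" for \<omega> i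
  proof (rule ccontr)
    assume "\<not> (L \<omega> i = 2 \<or> D \<omega> i = 2)"
    moreover have im: "i < m" using that by (simp add: N_def)
    ultimately have "c i (p i \<omega>) < 2" "c i (1 - p i \<omega>) < 2"
      using c_le_2[OF im, of "p i \<omega>"] c_le_2[OF im, of "1 - p i \<omega>"] by (auto simp: L_def D_def)
    then have "p i \<omega> \<le> 1/2" "1 - p i \<omega> \<le> 1/2"
      using t_up_w im that unfolding c_def
      by (intro score.crit_less_2_imp_le_half[OF sc[OF im]]; simp)+
    then show False using that by simp
  qed
  have fdp_le: "AE \<omega> in M. fdp m H h \<pi> t_up \<alpha> (\<lambda>i. p i \<omega>) \<le> \<alpha> * (\<Sum>i\<in>N. lo i \<omega>)"
    using AE_01 AE_half AE_noties
  proof eventually_elim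
    case (elim \<omega>)
    show ?case
      unfolding lo_def \<tau>_def W_def P_def N_def L_def[symmetric] D_def[symmetric]
    proof (rule fdp_le_loo_sum)
      fix i j assume *: "i < m" "H i = 0" "j < m" "L \<omega> i < 2"
      show "L \<omega> i \<noteq> D \<omega> j"
      proof (cases "j = i")
        case True
        then show ?thesis using LD_2[of i \<omega>] elim * by (auto simp: N_def)
      next
        case False
        then show ?thesis using elim * by (auto simp: N_def)
      qed
    next
      fix j t assume *: "j < m" "0 < t" "t \<le> t_up"
      show "(wgt (\<pi> j) t \<le> h j (p j \<omega>)) = (L \<omega> j \<le> t)"
        "(wgt (\<pi> j) t \<le> h j (1 - p j \<omega>)) = (D \<omega> j \<le> t)"
        unfolding L_def D_def c_def using elim(1) *
        by (intro score.wgt_le_iff[OF sc]; simp)+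
    qed (use t_up_range alpha_range H01 c_range LD_2 elim in \<open>auto simp: L_def D_def N_def\<close>)
  qed
  have hi_le: "AE \<omega> in M. (\<Sum>i\<in>N. hi i \<omega>) \<le> 1"
    using AE_01 AE_half
  proof eventually_elim
    case (elim \<omega>)
    show ?case
      unfolding hi_def \<tau>_def W_def P_def L_def[symmetric] D_def[symmetric]
    proof (rule sum_loo_weight_le_1)
      show "L \<omega> i = 2 \<or> D \<omega> i = 2" if "i \<in> N" for i
        using that elim by (intro LD_2) (auto simp: N_def)
    qed (use c_range c_le_2 in \<open>auto simp: L_def D_def N_def\<close>)
  qed
  \<comment> \<open>The expectation of a non-integrable function is \<open>0\<close>, so measurability of the FDP is not an issue.\<close>
  show ?thesis
  proof (cases "integrable M (\<lambda>\<omega>. fdp m H h \<pi> t_up \<alpha> (\<lambda>i. p i \<omega>))")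
    case True
    then have "expectation (\<lambda>\<omega>. fdp m H h \<pi> t_up \<alpha> (\<lambda>i. p i \<omega>)) \<le>
        expectation (\<lambda>\<omega>. \<alpha> * (\<Sum>i\<in>N. lo i \<omega>))"
      using lo_hi_int fdp_le by (intro integral_mono_AE) auto
    also have "\<dots> = \<alpha> * (\<Sum>i\<in>N. expectation (lo i))"
      using lo_hi_int by simp
    also have "\<dots> \<le> \<alpha> * (\<Sum>i\<in>N. expectation (hi i))"
      using swap alpha_range by (intro mult_left_mono sum_mono) auto
    also have "(\<Sum>i\<in>N. expectation (hi i)) = expectation (\<lambda>\<omega>. \<Sum>i\<in>N. hi i \<omega>)"
      using lo_hi_int by simp
    also have "\<alpha> * expectation (\<lambda>\<omega>. \<Sum>i\<in>N. hi i \<omega>) \<le> \<alpha> * 1"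
      using lo_hi_int hi_le alpha_range by (intro mult_left_mono integral_le_const) auto
    finally show ?thesis by simp
  next
    case False
    then show ?thesis using alpha_range by (simp add: not_integrable_integral_eq)
  qed
qed

end
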